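(* Let $\Omega$ be a completely regular Hausdorff topological space and let $(f_\alpha)$ be a net in $C(\Omega)$. Then $(f_\alpha)$ is uo-Cauchy in $C(\Omega)$ if and only if for every non-empty open set $U\subseteq\Omega$ and every $\varepsilon>0$ there exist a non-empty open set $V\subseteq U$ and an index $\alpha_0$ such that $|f_\alpha(t)-f_\beta(t)|<\varepsilon$ for all $t\in V$ and all $\alpha,\beta\geqslant\alpha_0$.
   Context: $C(\Omega)$ is the vector lattice of all real-valued continuous functions on $\Omega$ with pointwise operations and order. A net $(x_\alpha)$ in a vector lattice $X$ converges in order to $x$ if there is a net $(u_\gamma)$ in $X$, possibly with a different index set, such that $u_\gamma\downarrow 0$ (decreasing with infimum $0$ in $X$) and for every $\gamma$ there exists $\alpha_0$ with $|x_\alpha-x|\leqslant u_\gamma$ for all $\alpha\geqslant\alpha_0$. The net uo-converges to $x$ if for every $u\geqslant 0$ in $X$ the net $(|x_\alpha-x|\wedge u)$ converges in order to $0$. A net $(x_\alpha)_{\alpha\in\Lambda}$ is uo-Cauchy if the double net $(x_\alpha-x_\beta)$, indexed by $(\alpha,\beta)\in\Lambda^2$ with the coordinatewise order, uo-converges to $0$. *)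

theory Defs
  imports
    "HOL-Analysis.Analysis"
    "HOL-Library.Function_Algebras"
    "HOL-Library.Lub_Glb"
begin

definition directed_set :: "'i set \<Rightarrow> ('i \<Rightarrow> 'i \<Rightarrow> bool) \<Rightarrow> bool" where
  "directed_set I le \<longleftrightarrow>
     I \<noteq> {} \<and> reflp_on I le \<and> transp_on I le \<and>
     (\<forall>i\<in>I. \<forall>j\<in>I. \<exists>k\<in>I. le i k \<and> le j k)"

text \<open>In what follows \<open>X\<close> is a vector sublattice of an ambient lattice-ordered group, with the
  ambient operations and order. Infima are taken in \<open>X\<close>: by definition of \<^const>\<open>isGlb\<close>, only
  lower bounds that belong to \<open>X\<close> compete.\<close>

definition decreases_to ::
    "'x::ord set \<Rightarrow> 'i set \<Rightarrow> ('i \<Rightarrow> 'i \<Rightarrow> bool) \<Rightarrow> ('i \<Rightarrow> 'x) \<Rightarrow> 'x \<Rightarrow> bool" where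
  "decreases_to X I le u x \<longleftrightarrow>
     u \<in> I \<rightarrow> X \<and> (\<forall>i\<in>I. \<forall>j\<in>I. le i j \<longrightarrow> u j \<le> u i) \<and> isGlb X (u ` I) x"

definition modulus :: "'x::{ordered_ab_group_add, lattice} \<Rightarrow> 'x" where
  "modulus x = sup x (- x)"

text \<open>HOL cannot quantify existentially over the type of the index set of the dominating net
  \<open>u\<close>. Its index set is therefore a directed set whose elements have the type of the elements of
  \<open>X\<close>; lemma \<open>order_converges_anyI\<close> below shows that this is no restriction, since a
  decreasing net can be reindexed by its own range.\<close>

definition order_converges ::
    "'x::{ordered_ab_group_add, lattice} set \<Rightarrow> 'i set \<Rightarrow> ('i \<Rightarrow> 'i \<Rightarrow> bool) \<Rightarrow> ('i \<Rightarrow> 'x) \<Rightarrow> 'x \<Rightarrow> bool"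
  where
  "order_converges X I le x l \<longleftrightarrow>
     (\<exists>(G :: 'x set) leG u. directed_set G leG \<and> decreases_to X G leG u 0 \<and>
        (\<forall>g\<in>G. \<exists>i0\<in>I. \<forall>i\<in>I. le i0 i \<longrightarrow> modulus (x i - l) \<le> u g))"

definition uo_converges ::
    "'x::{ordered_ab_group_add, lattice} set \<Rightarrow> 'i set \<Rightarrow> ('i \<Rightarrow> 'i \<Rightarrow> bool) \<Rightarrow> ('i \<Rightarrow> 'x) \<Rightarrow> 'x \<Rightarrow> bool"
  where
  "uo_converges X I le x l \<longleftrightarrow>
     (\<forall>u\<in>X. 0 \<le> u \<longrightarrow> order_converges X I le (\<lambda>i. inf (modulus (x i - l)) u) 0)"

text \<open>\<^term>\<open>rel_prod le le\<close> is the coordinatewise order on pairs of indices.\<close>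

definition uo_Cauchy ::
    "'x::{ordered_ab_group_add, lattice} set \<Rightarrow> 'i set \<Rightarrow> ('i \<Rightarrow> 'i \<Rightarrow> bool) \<Rightarrow> ('i \<Rightarrow> 'x) \<Rightarrow> bool"
  where
  "uo_Cauchy X I le x \<longleftrightarrow>
     uo_converges X (I \<times> I) (rel_prod le le) (\<lambda>(i, j). x i - x j) 0"

text \<open>A function on the space is represented by its extension by \<open>0\<close> to the whole type, so that
  the pointwise operations and order of the function type are exactly those of \<open>C(\<Omega>)\<close>.\<close>

definition cfun_space :: "'a topology \<Rightarrow> ('a \<Rightarrow> real) set" where
  "cfun_space \<Omega> = {f. continuous_map \<Omega> euclideanreal f \<and> (\<forall>t. t \<notin> topspace \<Omega> \<longrightarrow> f t = 0)}"

lemma cfun_space_vector_sublattice: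
  assumes "f \<in> cfun_space \<Omega>" "g \<in> cfun_space \<Omega>"
  shows "0 \<in> cfun_space \<Omega>" "f + g \<in> cfun_space \<Omega>" "f - g \<in> cfun_space \<Omega>"
    "(\<lambda>t. c * f t) \<in> cfun_space \<Omega>" "sup f g \<in> cfun_space \<Omega>" "inf f g \<in> cfun_space \<Omega>"
    "modulus f \<in> cfun_space \<Omega>" "modulus f = (\<lambda>t. \<bar>f t\<bar>)"
proof -
  have f: "continuous_map \<Omega> euclideanreal f" "\<And>t. t \<notin> topspace \<Omega> \<Longrightarrow> f t = 0"
    and g: "continuous_map \<Omega> euclideanreal g" "\<And>t. t \<notin> topspace \<Omega> \<Longrightarrow> g t = 0"
    using assms by (simp_all add: cfun_space_def)
  show "0 \<in> cfun_space \<Omega>"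
    by (simp add: cfun_space_def zero_fun_def)
  show "f + g \<in> cfun_space \<Omega>"
    using f g by (simp add: cfun_space_def plus_fun_def continuous_map_add)
  show "f - g \<in> cfun_space \<Omega>"
    using f g by (simp add: cfun_space_def fun_diff_def continuous_map_diff)
  show "(\<lambda>t. c * f t) \<in> cfun_space \<Omega>"
    using f by (simp add: cfun_space_def continuous_map_real_mult_left)
  show "sup f g \<in> cfun_space \<Omega>"
    using f g by (simp add: cfun_space_def sup_fun_def sup_max continuous_map_real_max)
  show "inf f g \<in> cfun_space \<Omega>"
    using f g by (simp add: cfun_space_def inf_fun_def inf_min continuous_map_real_min)
  show m: "modulus f = (\<lambda>t. \<bar>f t\<bar>)"
    by (simp add: modulus_def fun_eq_iff sup_max abs_real_def max_def)
  show "modulus f \<in> cfun_space \<Omega>"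
    using f unfolding m by (simp add: cfun_space_def continuous_map_real_abs)
qed

lemma cfun_space_le_iff:
  assumes "f \<in> cfun_space \<Omega>" "g \<in> cfun_space \<Omega>"
  shows "f \<le> g \<longleftrightarrow> (\<forall>t\<in>topspace \<Omega>. f t \<le> g t)"
proof
  assume le: "\<forall>t\<in>topspace \<Omega>. f t \<le> g t"
  show "f \<le> g"
  proof (rule le_funI)
    fix t show "f t \<le> g t"
      using le assms by (cases "t \<in> topspace \<Omega>") (simp_all add: cfun_space_def)
  qed
qed (simp add: le_funD)

lemma order_converges_anyI:
  fixes G :: "'g set"
  assumes dir: "directed_set G leG" and dec: "decreases_to X G leG u 0"
    and dom: "\<And>g. g \<in> G \<Longrightarrow> \<exists>i0\<in>I. \<forall>i\<in>I. le i0 i \<longrightarrow> modulus (x i - l) \<le> u g"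
  shows "order_converges X I le x l"
  unfolding order_converges_def
proof (intro exI conjI)
  show "directed_set (u ` G) (\<ge>)"
    unfolding directed_set_def
  proof (intro conjI ballI)
    fix a b assume "a \<in> u ` G" "b \<in> u ` G"
    then obtain g h where gh: "g \<in> G" "h \<in> G" and ab: "a = u g" "b = u h"
      by blast
    from dir gh obtain k where k: "k \<in> G" "leG g k" "leG h k"
      unfolding directed_set_def by blast
    have "u k \<le> u g" "u k \<le> u h"
      using dec gh k unfolding decreases_to_def by blast+
    with ab k(1) show "\<exists>c\<in>u ` G. c \<le> a \<and> c \<le> b"
      by blast
  qed (use dir in \<open>auto simp: directed_set_def reflp_on_def transp_on_def\<close>)
  show "decreases_to X (u ` G) (\<ge>) id 0"
    using dec unfolding decreases_to_def by auto
  show "\<forall>g\<in>u ` G. \<exists>i0\<in>I. \<forall>i\<in>I. le i0 i \<longrightarrow> modulus (x i - l) \<le> id g"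
    using dom by auto
qed

end

theory Submission
  imports Defs
begin

text \<open>In \<open>C(\<Omega>)\<close> an infimum is governed by the topology rather than by pointwise values: if \<open>\<Omega>\<close> is
  completely regular, a set \<open>G\<close> of non-negative functions has infimum \<open>0\<close> exactly when every
  non-empty open set contains, for each \<open>\<epsilon> > 0\<close>, a point where some member of \<open>G\<close> is below \<open>\<epsilon>\<close>.
  Otherwise a multiple of a bump function would be a nonzero lower bound, and conversely a nonzero
  lower bound stays above a positive constant on some open set. This is
  \<open>isGlb_cfun_space_zero_iff\<close>.

  If the net is uo-Cauchy, truncation at the constant \<open>\<epsilon>\<close> gives dominating functions with infimum
  \<open>0\<close>, one of which is below \<open>\<epsilon>\<close> at a point of \<open>U\<close>; by continuity it is so on an open \<open>V \<subseteq> U\<close>, and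
  a truncated difference that is less than \<open>\<epsilon>\<close> is the difference itself.

  In the other direction, for \<open>u \<ge> 0\<close> the set of all functions that eventually dominate
  \<open>\<bar>f \<alpha> - f \<beta>\<bar> \<sqinter> u\<close> is closed under binary infima, so it is itself a decreasing net, and only its
  infimum has to be found. On a set \<open>V\<close> where the differences are eventually below \<open>\<epsilon>\<close> the function
  \<open>u\<close> can be pushed down by a bump function to \<open>u \<sqinter> \<epsilon>\<close> at a point of \<open>V\<close> and still dominate
  (\<open>cfun_space_cut_down\<close>). As such \<open>V\<close> occur inside every non-empty open set, the infimum is
  \<open>0\<close>.\<close>

lemma cfun_space_const_on:
  "(\<lambda>t. if t \<in> topspace \<Omega> then c else 0) \<in> cfun_space \<Omega>"
proof -
  have "continuous_map \<Omega> euclideanreal (\<lambda>t. if t \<in> topspace \<Omega> then c else 0)"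
    by (rule continuous_map_eq[of _ _ "\<lambda>t. c"]) auto
  then show ?thesis
    by (simp add: cfun_space_def)
qed

lemma openin_cfun_space_superlevel:
  assumes "w \<in> cfun_space \<Omega>"
  shows "openin \<Omega> {t \<in> topspace \<Omega>. c < w t}"
  using openin_continuous_map_preimage[of \<Omega> euclideanreal w "{c<..}"] assms
  by (simp add: cfun_space_def)

lemma openin_cfun_space_sublevel:
  assumes "w \<in> cfun_space \<Omega>"
  shows "openin \<Omega> {t \<in> topspace \<Omega>. w t < c}"
  using openin_continuous_map_preimage[of \<Omega> euclideanreal w "{..<c}"] assms
  by (simp add: cfun_space_def)

lemma cfun_space_bump:
  assumes "completely_regular_space \<Omega>" "openin \<Omega> V" "s \<in> V"
  obtains h where "h \<in> cfun_space \<Omega>" "\<And>t. 0 \<le> h t" "\<And>t. h t \<le> 1" "h s = 1"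
    "\<And>t. t \<notin> V \<Longrightarrow> h t = 0"
proof -
  have V: "V \<subseteq> topspace \<Omega>"
    using assms(2) by (rule openin_subset)
  have "closedin \<Omega> (topspace \<Omega> - V)" "s \<in> topspace \<Omega> - (topspace \<Omega> - V)"
    using assms V by auto
  then obtain k where k: "continuous_map \<Omega> (top_of_set {0..1::real}) k" "k s = 0"
      "k ` (topspace \<Omega> - V) \<subseteq> {1}"
    using assms(1) unfolding completely_regular_space_def by metis
  have kc: "continuous_map \<Omega> euclideanreal k" and k01: "\<And>t. t \<in> topspace \<Omega> \<Longrightarrow> k t \<in> {0..1}"
    using k(1) by (auto simp: continuous_map_in_subtopology)
  define h where "h t = (if t \<in> topspace \<Omega> then 1 - k t else 0)" for t
  have "continuous_map \<Omega> euclideanreal h"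
    by (rule continuous_map_eq[of _ _ "\<lambda>t. 1 - k t"])
       (auto simp: h_def intro!: continuous_map_diff kc)
  then have "h \<in> cfun_space \<Omega>"
    by (simp add: cfun_space_def h_def)
  moreover have "0 \<le> h t" "h t \<le> 1" for t
    using k01[of t] by (auto simp: h_def)
  moreover have "h s = 1"
    using k(2) V assms(3) by (auto simp: h_def)
  moreover have "h t = 0" if "t \<notin> V" for t
    using k(3) that by (auto simp: h_def)
  ultimately show thesis
    using that by blast
qed

lemma isGlb_zero_iff:
  fixes G :: "'x::{ord, zero} set"
  assumes "0 \<in> X" "\<And>g. g \<in> G \<Longrightarrow> 0 \<le> g"
  shows "isGlb X G 0 \<longleftrightarrow> (\<forall>w\<in>X. (\<forall>g\<in>G. w \<le> g) \<longrightarrow> w \<le> 0)"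
  using assms by (auto simp: isGlb_def isLb_def greatestP_def setge_def setle_def)

text \<open>Lower bounds compete only if they are continuous, so the pointwise infimum may well be
  positive at some points; but it cannot be bounded away from \<open>0\<close> on an open set, since a multiple
  of a bump function would fit below it.\<close>

lemma isGlb_cfun_space_zero_iff:
  assumes cr: "completely_regular_space \<Omega>"
    and G: "G \<subseteq> cfun_space \<Omega>" "\<And>g. g \<in> G \<Longrightarrow> 0 \<le> g"
  shows "isGlb (cfun_space \<Omega>) G 0 \<longleftrightarrow>
    (\<forall>U \<epsilon>. openin \<Omega> U \<and> U \<noteq> {} \<and> \<epsilon> > 0 \<longrightarrow> (\<exists>g\<in>G. \<exists>t\<in>U. g t < \<epsilon>))"
    (is "_ \<longleftrightarrow> ?small")
proof -
  have 0: "0 \<in> cfun_space \<Omega>"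
    by (simp add: cfun_space_def zero_fun_def)
  have "(\<forall>w\<in>cfun_space \<Omega>. (\<forall>g\<in>G. w \<le> g) \<longrightarrow> w \<le> 0) \<longleftrightarrow> ?small"
  proof (intro iffI allI impI ballI)
    fix U and \<epsilon> :: real
    assume lower: "\<forall>w\<in>cfun_space \<Omega>. (\<forall>g\<in>G. w \<le> g) \<longrightarrow> w \<le> 0"
      and U: "openin \<Omega> U \<and> U \<noteq> {} \<and> \<epsilon> > 0"
    then obtain s where s: "s \<in> U"
      by blast
    obtain h where h: "h \<in> cfun_space \<Omega>" "\<And>t. 0 \<le> h t" "\<And>t. h t \<le> 1" "h s = 1"
        "\<And>t. t \<notin> U \<Longrightarrow> h t = 0"
      using cfun_space_bump[OF cr] U s by metis
    show "\<exists>g\<in>G. \<exists>t\<in>U. g t < \<epsilon>"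
    proof (rule ccontr)
      assume "\<not> (\<exists>g\<in>G. \<exists>t\<in>U. g t < \<epsilon>)"
      then have ge: "\<epsilon> \<le> g t" if "g \<in> G" "t \<in> U" for g t
        using that by force
      have "(\<lambda>t. \<epsilon> * h t) \<le> g" if g: "g \<in> G" for g
      proof (rule le_funI)
        fix t show "\<epsilon> * h t \<le> g t"
        proof (cases "t \<in> U")
          case True
          have "\<epsilon> * h t \<le> \<epsilon>"
            using h(3)[of t] U by (simp add: mult_left_le)
          then show ?thesis
            using ge[OF g True] by linarith
        next
          case False
          then show ?thesis
            using h(5) G(2)[OF g] by (simp add: le_fun_def)
        qed
      qed
      then have "(\<lambda>t. \<epsilon> * h t) \<le> 0"
        using lower cfun_space_vector_sublattice(4)[OF h(1) h(1)] by blast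
      then show False
        using le_funD[of "\<lambda>t. \<epsilon> * h t" 0 s] h(4) U by simp
    qed
  next
    fix w
    assume small: ?small and w: "w \<in> cfun_space \<Omega>" and le: "\<forall>g\<in>G. w \<le> g"
    show "w \<le> 0"
    proof (rule ccontr)
      assume "\<not> w \<le> 0"
      then obtain s where s: "s \<in> topspace \<Omega>" "w s > 0"
        using cfun_space_le_iff[OF w 0] by (auto simp: not_le)
      define U where "U = {t \<in> topspace \<Omega>. w s / 2 < w t}"
      have "openin \<Omega> U"
        unfolding U_def by (rule openin_cfun_space_superlevel[OF w])
      moreover have "s \<in> U"
        using s by (simp add: U_def)
      moreover have "w s / 2 > 0"
        using s(2) by simp
      ultimately obtain g t where g: "g \<in> G" "t \<in> U" "g t < w s / 2"
        using small by blast
      have "w s / 2 < w t"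
        using g(2) by (simp add: U_def)
      moreover have "w t \<le> g t"
        using le g(1) by (simp add: le_fun_def)
      ultimately show False
        using g(3) by linarith
    qed
  qed
  then show ?thesis
    using isGlb_zero_iff[of "cfun_space \<Omega>" G] 0 G(2) by simp
qed

text \<open>The function \<open>g = u - h * (u - u \<sqinter> \<epsilon>)\<close>, with \<open>h\<close> a bump at \<open>s\<close> supported in \<open>V\<close>, lies between
  \<open>u \<sqinter> \<epsilon>\<close> and \<open>u\<close>; it equals the former at \<open>s\<close> and the latter outside \<open>V\<close>.\<close>

lemma cfun_space_cut_down:
  assumes cr: "completely_regular_space \<Omega>" and V: "openin \<Omega> V" "s \<in> V"
    and u: "u \<in> cfun_space \<Omega>" "0 \<le> u" and \<epsilon>: "0 \<le> \<epsilon>"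
  obtains g where "g \<in> cfun_space \<Omega>" "0 \<le> g" "g s \<le> \<epsilon>"
    "\<And>t. t \<in> V \<Longrightarrow> min \<epsilon> (u t) \<le> g t" "\<And>t. t \<notin> V \<Longrightarrow> g t = u t"
proof -
  obtain h where h: "h \<in> cfun_space \<Omega>" "\<And>t. 0 \<le> h t" "\<And>t. h t \<le> 1" "h s = 1"
      "\<And>t. t \<notin> V \<Longrightarrow> h t = 0"
    using cfun_space_bump[OF cr V] by metis
  define g where "g t = u t - h t * (u t - min \<epsilon> (u t))" for t
  have cont: "continuous_map \<Omega> euclideanreal u" "continuous_map \<Omega> euclideanreal h"
    using u h(1) by (simp_all add: cfun_space_def)
  have "continuous_map \<Omega> euclideanreal g"
    unfolding g_def
    by (intro continuous_map_diff continuous_map_real_mult continuous_map_real_min cont) auto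
  then have "g \<in> cfun_space \<Omega>"
    using u h by (simp add: cfun_space_def g_def)
  moreover have ge: "min \<epsilon> (u t) \<le> g t" for t
  proof -
    have "h t * (u t - min \<epsilon> (u t)) \<le> 1 * (u t - min \<epsilon> (u t))"
      by (rule mult_right_mono) (use h(3) in auto)
    then show ?thesis
      by (simp add: g_def)
  qed
  moreover have "0 \<le> g"
  proof (rule le_funI)
    fix t show "0 t \<le> g t"
      using ge[of t] le_funD[OF u(2), of t] \<epsilon> by simp
  qed
  moreover have "g s \<le> \<epsilon>"
    using h(4) by (simp add: g_def)
  moreover have "g t = u t" if "t \<notin> V" for t
    using h(5)[OF that] by (simp add: g_def)
  ultimately show thesis
    using that by blast
qed

lemma modulus_inf_modulus:
  fixes u d :: "'a \<Rightarrow> real"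
  assumes "0 \<le> u"
  shows "modulus (inf (modulus (d - 0)) u - 0) = (\<lambda>t. min \<bar>d t\<bar> (u t))"
proof -
  have modulus_fun: "modulus v = (\<lambda>t. \<bar>v t\<bar>)" for v :: "'a \<Rightarrow> real"
    by (simp add: modulus_def fun_eq_iff sup_max abs_real_def max_def)
  show ?thesis
    using assms by (auto simp: modulus_fun fun_eq_iff le_fun_def inf_min)
qed

text \<open>One threshold \<open>\<alpha>\<^sub>0\<close> for both indices suffices: because \<open>I\<close> is directed, every pair of
  thresholds is dominated by a diagonal pair \<open>(\<alpha>\<^sub>0, \<alpha>\<^sub>0)\<close>.\<close>

lemma uo_Cauchy_fun_iff:
  fixes f :: "'i \<Rightarrow> 'a \<Rightarrow> real"
  assumes dir: "directed_set I le"
  shows "uo_Cauchy X I le f \<longleftrightarrow>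
    (\<forall>u\<in>X. 0 \<le> u \<longrightarrow> (\<exists>(G :: ('a \<Rightarrow> real) set) leG v.
       directed_set G leG \<and> decreases_to X G leG v 0 \<and>
       (\<forall>g\<in>G. \<exists>\<alpha>\<^sub>0\<in>I. \<forall>\<alpha>\<in>I. \<forall>\<beta>\<in>I. le \<alpha>\<^sub>0 \<alpha> \<and> le \<alpha>\<^sub>0 \<beta> \<longrightarrow>
          (\<forall>t. min \<bar>f \<alpha> t - f \<beta> t\<bar> (u t) \<le> v g t))))"
proof -
  have tails: "(\<exists>p\<in>I \<times> I. \<forall>q\<in>I \<times> I. rel_prod le le p q \<longrightarrow> P q) \<longleftrightarrow>
      (\<exists>\<alpha>\<^sub>0\<in>I. \<forall>\<alpha>\<in>I. \<forall>\<beta>\<in>I. le \<alpha>\<^sub>0 \<alpha> \<and> le \<alpha>\<^sub>0 \<beta> \<longrightarrow> P (\<alpha>, \<beta>))" (is "?pairs \<longleftrightarrow> ?diag") for P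
  proof
    assume ?pairs
    then obtain a b where ab: "a \<in> I" "b \<in> I"
      and P: "\<And>\<alpha> \<beta>. \<alpha> \<in> I \<Longrightarrow> \<beta> \<in> I \<Longrightarrow> le a \<alpha> \<Longrightarrow> le b \<beta> \<Longrightarrow> P (\<alpha>, \<beta>)"
      by (fastforce simp: rel_prod_inject)
    obtain c where c: "c \<in> I" "le a c" "le b c"
      using dir ab unfolding directed_set_def by blast
    have "le a \<alpha>" "le b \<alpha>" if "\<alpha> \<in> I" "le c \<alpha>" for \<alpha>
      using dir that ab c unfolding directed_set_def transp_on_def by blast+
    then show ?diag
      using P c(1) by blast
  next
    assume ?diag
    then obtain a where "a \<in> I" "\<forall>\<alpha>\<in>I. \<forall>\<beta>\<in>I. le a \<alpha> \<and> le a \<beta> \<longrightarrow> P (\<alpha>, \<beta>)"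
      by blast
    then show ?pairs
      by (intro bexI[of _ "(a, a)"]) auto
  qed
  have *: "modulus (inf (modulus ((case p of (i, j) \<Rightarrow> f i - f j) - 0)) u - 0) \<le> v \<longleftrightarrow>
      (\<forall>t. min \<bar>f (fst p) t - f (snd p) t\<bar> (u t) \<le> v t)" if "0 \<le> u" for p u v
    unfolding modulus_inf_modulus[OF that] by (simp add: le_fun_def case_prod_beta)
  show ?thesis
    unfolding uo_Cauchy_def uo_converges_def order_converges_def
    by (simp only: * tails fst_conv snd_conv cong: imp_cong)
qed

text \<open>The constant \<open>\<epsilon>\<close> is itself the truncation level: a truncated difference that is less than
  \<open>\<epsilon>\<close> cannot have been cut off.\<close>

lemma uo_Cauchy_imp_locally_uniformly_small:
  assumes cr: "completely_regular_space \<Omega>" and dir: "directed_set \<Lambda> le"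
    and Cauchy: "uo_Cauchy (cfun_space \<Omega>) \<Lambda> le f"
    and U: "openin \<Omega> U" "U \<noteq> {}" and \<epsilon>: "\<epsilon> > 0"
  shows "\<exists>V \<alpha>\<^sub>0. openin \<Omega> V \<and> V \<noteq> {} \<and> V \<subseteq> U \<and> \<alpha>\<^sub>0 \<in> \<Lambda> \<and>
    (\<forall>t\<in>V. \<forall>\<alpha>\<in>\<Lambda>. \<forall>\<beta>\<in>\<Lambda>. le \<alpha>\<^sub>0 \<alpha> \<and> le \<alpha>\<^sub>0 \<beta> \<longrightarrow> \<bar>f \<alpha> t - f \<beta> t\<bar> < \<epsilon>)"
proof -
  define u where "u = (\<lambda>t. if t \<in> topspace \<Omega> then \<epsilon> else 0)"
  have "u \<in> cfun_space \<Omega>" "0 \<le> u"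
    using cfun_space_const_on \<epsilon> by (auto simp: u_def le_fun_def)
  then obtain G leG and v :: "('a \<Rightarrow> real) \<Rightarrow> 'a \<Rightarrow> real" where
    G: "decreases_to (cfun_space \<Omega>) G leG v 0"
    and dom: "\<forall>g\<in>G. \<exists>\<alpha>\<^sub>0\<in>\<Lambda>. \<forall>\<alpha>\<in>\<Lambda>. \<forall>\<beta>\<in>\<Lambda>. le \<alpha>\<^sub>0 \<alpha> \<and> le \<alpha>\<^sub>0 \<beta> \<longrightarrow>
          (\<forall>t. min \<bar>f \<alpha> t - f \<beta> t\<bar> (u t) \<le> v g t)"
    using Cauchy unfolding uo_Cauchy_fun_iff[OF dir] by metis
  from G have v: "v ` G \<subseteq> cfun_space \<Omega>" and glb: "isGlb (cfun_space \<Omega>) (v ` G) 0"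
    by (auto simp: decreases_to_def)
  from glb have "0 \<le> w" if "w \<in> v ` G" for w
    using that by (auto simp: isGlb_def isLb_def greatestP_def setge_def)
  then obtain g s where g: "g \<in> G" and s: "s \<in> U" "v g s < \<epsilon>"
    using isGlb_cfun_space_zero_iff[OF cr v] glb U \<epsilon> by blast
  obtain \<alpha>\<^sub>0 where \<alpha>\<^sub>0: "\<alpha>\<^sub>0 \<in> \<Lambda>" "\<And>\<alpha> \<beta> t. \<alpha> \<in> \<Lambda> \<Longrightarrow> \<beta> \<in> \<Lambda> \<Longrightarrow> le \<alpha>\<^sub>0 \<alpha> \<Longrightarrow> le \<alpha>\<^sub>0 \<beta> \<Longrightarrow>
      min \<bar>f \<alpha> t - f \<beta> t\<bar> (u t) \<le> v g t"
    using dom g by metis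
  define V where "V = U \<inter> {t \<in> topspace \<Omega>. v g t < \<epsilon>}"
  have "openin \<Omega> V"
    using U(1) v g openin_cfun_space_sublevel unfolding V_def by (intro openin_Int) auto
  moreover have "s \<in> V"
    using s openin_subset[OF U(1)] by (auto simp: V_def)
  moreover have "\<bar>f \<alpha> t - f \<beta> t\<bar> < \<epsilon>"
    if "t \<in> V" "\<alpha> \<in> \<Lambda>" "\<beta> \<in> \<Lambda>" "le \<alpha>\<^sub>0 \<alpha>" "le \<alpha>\<^sub>0 \<beta>" for t \<alpha> \<beta>
    using \<alpha>\<^sub>0(2)[OF that(2-5), of t] that(1) by (auto simp: V_def u_def min_def split: if_splits)
  ultimately show ?thesis
    using \<alpha>\<^sub>0(1) by (intro exI[of _ V] exI[of _ \<alpha>\<^sub>0]) (auto simp: V_def)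
qed

text \<open>The set of all eventual upper bounds of \<open>\<bar>f \<alpha> - f \<beta>\<bar> \<sqinter> u\<close> serves as its own index set, ordered
  downwards. It contains the functions obtained by cutting \<open>u\<close> down, which force its infimum to be
  \<open>0\<close>.\<close>

lemma locally_uniformly_small_imp_uo_Cauchy:
  assumes cr: "completely_regular_space \<Omega>" and dir: "directed_set \<Lambda> le"
    and small: "\<And>U \<epsilon>. openin \<Omega> U \<Longrightarrow> U \<noteq> {} \<Longrightarrow> \<epsilon> > 0 \<Longrightarrow>
      \<exists>V \<alpha>\<^sub>0. openin \<Omega> V \<and> V \<noteq> {} \<and> V \<subseteq> U \<and> \<alpha>\<^sub>0 \<in> \<Lambda> \<and>
        (\<forall>t\<in>V. \<forall>\<alpha>\<in>\<Lambda>. \<forall>\<beta>\<in>\<Lambda>. le \<alpha>\<^sub>0 \<alpha> \<and> le \<alpha>\<^sub>0 \<beta> \<longrightarrow> \<bar>f \<alpha> t - f \<beta> t\<bar> < \<epsilon>)"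
  shows "uo_Cauchy (cfun_space \<Omega>) \<Lambda> le f"
  unfolding uo_Cauchy_fun_iff[OF dir]
proof (intro ballI impI)
  fix u assume u: "u \<in> cfun_space \<Omega>" "0 \<le> u"
  define dominates where "dominates \<alpha>\<^sub>0 g \<longleftrightarrow>
    (\<forall>\<alpha>\<in>\<Lambda>. \<forall>\<beta>\<in>\<Lambda>. le \<alpha>\<^sub>0 \<alpha> \<and> le \<alpha>\<^sub>0 \<beta> \<longrightarrow> (\<forall>t. min \<bar>f \<alpha> t - f \<beta> t\<bar> (u t) \<le> g t))" for \<alpha>\<^sub>0 g
  define G where "G = {g \<in> cfun_space \<Omega>. 0 \<le> g \<and> (\<exists>\<alpha>\<^sub>0\<in>\<Lambda>. dominates \<alpha>\<^sub>0 g)}"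
  have directed: "directed_set G (\<ge>)"
    unfolding directed_set_def
  proof (intro conjI ballI)
    obtain \<alpha>\<^sub>0 where "\<alpha>\<^sub>0 \<in> \<Lambda>"
      using dir unfolding directed_set_def by blast
    then have "u \<in> G"
      using u by (auto simp: G_def dominates_def)
    then show "G \<noteq> {}"
      by blast
  next
    fix g h assume gh: "g \<in> G" "h \<in> G"
    then obtain a b where ab: "a \<in> \<Lambda>" "b \<in> \<Lambda>" "dominates a g" "dominates b h"
      unfolding G_def by blast
    obtain c where c: "c \<in> \<Lambda>" "le a c" "le b c"
      using dir ab(1,2) unfolding directed_set_def by blast
    have "le a \<alpha>" "le b \<alpha>" if "\<alpha> \<in> \<Lambda>" "le c \<alpha>" for \<alpha>
      using dir that ab c unfolding directed_set_def transp_on_def by blast+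
    then have "dominates c (inf g h)"
      using ab(3,4) unfolding dominates_def by (simp add: inf_min)
    moreover have "inf g h \<in> cfun_space \<Omega>" "0 \<le> inf g h"
      using gh cfun_space_vector_sublattice(6) by (auto simp: G_def)
    ultimately have "inf g h \<in> G"
      using c(1) by (auto simp: G_def)
    then show "\<exists>k\<in>G. k \<le> g \<and> k \<le> h"
      by (intro bexI[of _ "inf g h"]) auto
  qed (auto simp: reflp_on_def transp_on_def)
  have "\<exists>g\<in>G. \<exists>t\<in>U. g t < \<epsilon>" if U: "openin \<Omega> U \<and> U \<noteq> {} \<and> \<epsilon> > 0" for U and \<epsilon> :: real
  proof -
    \<comment> \<open>Half of \<open>\<epsilon>\<close> leaves room for the strict inequality, since cutting down reaches
      its level exactly.\<close>
    obtain V \<alpha>\<^sub>0 where V: "openin \<Omega> V" "V \<noteq> {}" "V \<subseteq> U" and \<alpha>\<^sub>0: "\<alpha>\<^sub>0 \<in> \<Lambda>"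
      and less: "\<And>t \<alpha> \<beta>. t \<in> V \<Longrightarrow> \<alpha> \<in> \<Lambda> \<Longrightarrow> \<beta> \<in> \<Lambda> \<Longrightarrow> le \<alpha>\<^sub>0 \<alpha> \<Longrightarrow> le \<alpha>\<^sub>0 \<beta> \<Longrightarrow>
        \<bar>f \<alpha> t - f \<beta> t\<bar> < \<epsilon> / 2"
      using small[of U "\<epsilon> / 2"] U by (metis half_gt_zero)
    obtain s where s: "s \<in> V"
      using V(2) by blast
    obtain g where g: "g \<in> cfun_space \<Omega>" "0 \<le> g" "g s \<le> \<epsilon> / 2"
        "\<And>t. t \<in> V \<Longrightarrow> min (\<epsilon> / 2) (u t) \<le> g t" "\<And>t. t \<notin> V \<Longrightarrow> g t = u t"
      using cfun_space_cut_down[OF cr V(1) s u, of "\<epsilon> / 2"] U by auto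
    have "min \<bar>f \<alpha> t - f \<beta> t\<bar> (u t) \<le> g t"
      if "\<alpha> \<in> \<Lambda>" "\<beta> \<in> \<Lambda>" "le \<alpha>\<^sub>0 \<alpha>" "le \<alpha>\<^sub>0 \<beta>" for \<alpha> \<beta> t
      using g(4,5)[of t] less[OF _ that, of t] by (cases "t \<in> V") (auto simp: min_def split: if_splits)
    then have "g \<in> G"
      using g(1,2) \<alpha>\<^sub>0 by (auto simp: G_def dominates_def)
    moreover have "g s < \<epsilon>"
      using g(3) U by linarith
    ultimately show ?thesis
      using s V(3) by blast
  qed
  then have "isGlb (cfun_space \<Omega>) G 0"
    by (subst isGlb_cfun_space_zero_iff[OF cr]) (auto simp: G_def)
  then have "decreases_to (cfun_space \<Omega>) G (\<ge>) id 0"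
    by (auto simp: decreases_to_def G_def)
  moreover have "\<forall>g\<in>G. \<exists>\<alpha>\<^sub>0\<in>\<Lambda>. dominates \<alpha>\<^sub>0 (id g)"
    by (auto simp: G_def)
  ultimately show "\<exists>(G :: ('a \<Rightarrow> real) set) leG v.
      directed_set G leG \<and> decreases_to (cfun_space \<Omega>) G leG v 0 \<and>
      (\<forall>g\<in>G. \<exists>\<alpha>\<^sub>0\<in>\<Lambda>. \<forall>\<alpha>\<in>\<Lambda>. \<forall>\<beta>\<in>\<Lambda>. le \<alpha>\<^sub>0 \<alpha> \<and> le \<alpha>\<^sub>0 \<beta> \<longrightarrow>
         (\<forall>t. min \<bar>f \<alpha> t - f \<beta> t\<bar> (u t) \<le> v g t))"
    using directed unfolding dominates_def by blast
qed

theorem corollary3p3: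
  fixes \<Omega> :: "'a topology"
    and \<Lambda> :: "'i set" and le :: "'i \<Rightarrow> 'i \<Rightarrow> bool"
    and f :: "'i \<Rightarrow> 'a \<Rightarrow> real"
  assumes "completely_regular_space \<Omega>" and "Hausdorff_space \<Omega>"
    and "directed_set \<Lambda> le" and "f \<in> \<Lambda> \<rightarrow> cfun_space \<Omega>"
  shows "uo_Cauchy (cfun_space \<Omega>) \<Lambda> le f \<longleftrightarrow>
    (\<forall>U \<epsilon>. openin \<Omega> U \<and> U \<noteq> {} \<and> \<epsilon> > 0 \<longrightarrow>
      (\<exists>V \<alpha>\<^sub>0. openin \<Omega> V \<and> V \<noteq> {} \<and> V \<subseteq> U \<and> \<alpha>\<^sub>0 \<in> \<Lambda> \<and>
        (\<forall>t\<in>V. \<forall>\<alpha>\<in>\<Lambda>. \<forall>\<beta>\<in>\<Lambda>. le \<alpha>\<^sub>0 \<alpha> \<and> le \<alpha>\<^sub>0 \<beta> \<longrightarrow> \<bar>f \<alpha> t - f \<beta> t\<bar> < \<epsilon>)))"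
  using uo_Cauchy_imp_locally_uniformly_small[OF assms(1,3), of f]
    locally_uniformly_small_imp_uo_Cauchy[OF assms(1,3), of f]
  by blast

end
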